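(* Let $Y_0$ be a random variable with values in $(0,\infty)$, and let $p_c$ be the critical parameter of the Derrida--Retaux model with initial law $(1-p)\delta_0+pP_{Y_0}$, $p\in[0,1]$. Then $p_c>0$ if and only if $\mathbb{E}(Y_0\,2^{Y_0})<\infty$.
   Context: The Derrida--Retaux model: let $Y_0$ be a random variable with values in $(0,\infty)$, $P_{Y_0}$ its law, $\delta_0$ the Dirac measure at $0$, and $p\in[0,1]$. The random variable $X_0\ge 0$ has law $(1-p)\delta_0+pP_{Y_0}$, and the laws of $X_n$ are defined recursively by: for all $n\ge 0$, $$X_{n+1}\ \overset{\mathrm{law}}{=}\ (X_n+\widetilde X_n-1)^+,$$ where $\widetilde X_n$ is an independent copy of $X_n$ and $a^+:=\max\{a,0\}$. The free energy is $F_\infty(p):=\lim_{n\to\infty}\mathbb{E}(X_n)/2^n\in[0,\infty]$, where the sequence $\mathbb{E}(X_n)/2^n$ is non-increasing in $n$ (it is identically $\infty$ if $\mathbb{E}(X_0)=\infty$). The function $p\mapsto F_\infty(p)$ is non-decreasing, and the critical parameter $p_c\in[0,1]$ is the number such that $F_\infty(p)>0$ if $p>p_c$ and $F_\infty(p)=0$ if $p<p_c$ (so $p_c=0$ means $F_\infty(p)>0$ for all $p>0$, and $p_c=1$ means $F_\infty(p)=0$ for all $p<1$). *)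

theory Defs
  imports "HOL-Probability.Probability"
begin

text \<open>
  The Derrida--Retaux model. Only the laws of the random variables \<open>X\<^sub>n\<close> matter, so the
  recursion is carried out on Borel measures on the real line; \<open>\<nu>\<close> is always the law of \<open>Y\<^sub>0\<close>.
\<close>

text \<open>The mixture \<open>(1 - p) \<delta>\<^sub>0 + p \<nu>\<close>, meaningful for \<open>p \<in> [0, 1]\<close>.\<close>

definition dr_init :: "real measure \<Rightarrow> real \<Rightarrow> real measure" where
  "dr_init \<nu> p = measure_of UNIV (sets borel)
     (\<lambda>A. ennreal (1 - p) * emeasure (return borel 0) A + ennreal p * emeasure \<nu> A)"

text \<open>
  The law of \<open>X\<^sub>n\<close>. The law of a pair of independent copies of \<open>X\<^sub>n\<close> is the product measure.
\<close>

primrec dr_law :: "real measure \<Rightarrow> real \<Rightarrow> nat \<Rightarrow> real measure" where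
  "dr_law \<nu> p 0 = dr_init \<nu> p"
| "dr_law \<nu> p (Suc n) =
     distr (dr_law \<nu> p n \<Otimes>\<^sub>M dr_law \<nu> p n) borel (\<lambda>(x, x'). max (x + x' - 1) 0)"

text \<open>Expectation of a nonnegative random variable with law \<open>\<mu>\<close>, possibly infinite.\<close>

definition mean :: "real measure \<Rightarrow> ennreal" where
  "mean \<mu> = (\<integral>\<^sup>+ x. ennreal x \<partial>\<mu>)"

text \<open>The limit always exists; see \<open>dr_free_energy_LIMSEQ\<close> below.\<close>

definition dr_free_energy :: "real measure \<Rightarrow> real \<Rightarrow> ennreal" where
  "dr_free_energy \<nu> p = lim (\<lambda>n. mean (dr_law \<nu> p n) / 2 ^ n)"

definition is_critical_parameter :: "(real \<Rightarrow> ennreal) \<Rightarrow> real \<Rightarrow> bool" where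
  "is_critical_parameter F c \<longleftrightarrow> c \<in> {0..1} \<and>
     (\<forall>p\<in>{0..1}. (p > c \<longrightarrow> F p > 0) \<and> (p < c \<longrightarrow> F p = 0))"

text \<open>Existence and uniqueness are established in \<open>is_critical_parameter_ex1\<close> below.\<close>

definition dr_critical_parameter :: "real measure \<Rightarrow> real" where
  "dr_critical_parameter \<nu> = (THE c. is_critical_parameter (dr_free_energy \<nu>) c)"


subsection \<open>Well-definedness\<close>

lemma sets_dr_init [measurable_cong, simp]: "sets (dr_init \<nu> p) = sets borel"
  unfolding dr_init_def using sets.sets_measure_of_eq[of borel] by (simp only: space_borel)

lemma space_dr_init [simp]: "space (dr_init \<nu> p) = UNIV"
  using sets_eq_imp_space_eq[OF sets_dr_init[of \<nu> p]] by (simp only: space_borel)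

lemma emeasure_dr_init:
  assumes "sets \<nu> = sets borel" "A \<in> sets borel"
  shows "emeasure (dr_init \<nu> p) A = ennreal (1 - p) * indicator A 0 + ennreal p * emeasure \<nu> A"
proof -
  let ?f = "\<lambda>A. ennreal (1 - p) * emeasure (return borel 0) A + ennreal p * emeasure \<nu> A"
  have "emeasure (dr_init \<nu> p) A = ?f A"
  proof (rule emeasure_measure_of[OF dr_init_def])
    show "A \<in> sets (dr_init \<nu> p)" using assms by simp
    show "positive (sets (dr_init \<nu> p)) ?f" by (simp add: positive_def)
    show "countably_additive (sets (dr_init \<nu> p)) ?f"
    proof (rule countably_additiveI)
      fix B :: "nat \<Rightarrow> real set"
      assume B: "range B \<subseteq> sets (dr_init \<nu> p)" "disjoint_family B"
      have "(\<Sum>i. emeasure (return borel 0) (B i)) = emeasure (return borel 0) (\<Union>i. B i)"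
        using B by (intro suminf_emeasure) auto
      moreover have "(\<Sum>i. emeasure \<nu> (B i)) = emeasure \<nu> (\<Union>i. B i)"
        using B assms by (intro suminf_emeasure) auto
      ultimately show "(\<Sum>i. ?f (B i)) = ?f (\<Union>i. B i)"
        by (simp add: suminf_add[symmetric])
    qed
  qed auto
  then show ?thesis using assms by simp
qed

lemma prob_space_dr_init:
  assumes "prob_space \<nu>" "sets \<nu> = sets borel" "p \<in> {0..1}"
  shows "prob_space (dr_init \<nu> p)"
proof
  have "space \<nu> = UNIV" using sets_eq_imp_space_eq[OF assms(2)] by simp
  then have "emeasure \<nu> UNIV = 1" using prob_space.emeasure_space_1[OF assms(1)] by simp
  then show "emeasure (dr_init \<nu> p) (space (dr_init \<nu> p)) = 1"
    using assms by (simp add: emeasure_dr_init flip: ennreal_plus)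
qed

lemma nn_integral_dr_init:
  assumes sets: "sets \<nu> = sets borel" and f: "f \<in> borel_measurable borel"
  shows "(\<integral>\<^sup>+ x. f x \<partial>dr_init \<nu> p) = ennreal (1 - p) * f 0 + ennreal p * (\<integral>\<^sup>+ x. f x \<partial>\<nu>)"
  using f
proof (induction rule: borel_measurable_induct)
  case (cong f g)
  then have "f = g" by auto
  with cong show ?case by simp
next
  case (set A)
  then show ?case using sets by (simp add: emeasure_dr_init)
next
  case (mult u c)
  then show ?case using sets
    by (simp add: nn_integral_cmult measurable_cong_sets[OF sets refl]
        measurable_cong_sets[OF sets_dr_init refl] distrib_left mult.left_commute)
next
  case (add u v)
  then show ?case using sets
    by (simp add: nn_integral_add measurable_cong_sets[OF sets refl]
        measurable_cong_sets[OF sets_dr_init refl] distrib_left ac_simps)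
next
  case (seq U)
  have m: "U i \<in> borel_measurable \<nu>" "U i \<in> borel_measurable (dr_init \<nu> p)" for i
    using seq(1)[of i] by (simp_all add: measurable_cong_sets[OF sets refl] measurable_cong_sets[OF sets_dr_init refl])
  have i0: "incseq (\<lambda>i. ennreal (1 - p) * U i 0)"
    using \<open>incseq U\<close> by (auto simp: incseq_def le_fun_def intro: mult_left_mono)
  have i1: "incseq (\<lambda>i. ennreal p * (\<integral>\<^sup>+ x. U i x \<partial>\<nu>))"
    using \<open>incseq U\<close> by (auto simp: incseq_def le_fun_def intro!: mult_left_mono nn_integral_mono)
  have "(\<integral>\<^sup>+ x. (SUP i. U i) x \<partial>dr_init \<nu> p) = (SUP i. \<integral>\<^sup>+ x. U i x \<partial>dr_init \<nu> p)"
    unfolding SUP_apply by (rule nn_integral_monotone_convergence_SUP) (use seq m in auto)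
  also have "\<dots> = (SUP i. ennreal (1 - p) * U i 0 + ennreal p * (\<integral>\<^sup>+ x. U i x \<partial>\<nu>))"
    using seq by simp
  also have "\<dots> = (SUP i. ennreal (1 - p) * U i 0) + (SUP i. ennreal p * (\<integral>\<^sup>+ x. U i x \<partial>\<nu>))"
    by (rule ennreal_SUP_add[OF i0 i1])
  also have "\<dots> = ennreal (1 - p) * (SUP i. U i) 0 + ennreal p * (SUP i. \<integral>\<^sup>+ x. U i x \<partial>\<nu>)"
    unfolding SUP_apply SUP_mult_left_ennreal ..
  also have "(SUP i. \<integral>\<^sup>+ x. U i x \<partial>\<nu>) = (\<integral>\<^sup>+ x. (SUP i. U i) x \<partial>\<nu>)"
    unfolding SUP_apply by (rule nn_integral_monotone_convergence_SUP[symmetric]) (use seq m in auto)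
  finally show ?case .
qed

lemma sets_dr_law [measurable_cong, simp]: "sets (dr_law \<nu> p n) = sets borel"
  by (cases n) auto

lemma space_dr_law [simp]: "space (dr_law \<nu> p n) = UNIV"
  using sets_eq_imp_space_eq[OF sets_dr_law[of \<nu> p n]] by (simp only: space_borel)

lemma prob_space_dr_law:
  assumes "prob_space \<nu>" "sets \<nu> = sets borel" "p \<in> {0..1}"
  shows "prob_space (dr_law \<nu> p n)"
proof (induction n)
  case 0
  then show ?case using prob_space_dr_init[OF assms] by simp
next
  case (Suc n)
  then interpret prob_space "dr_law \<nu> p n" .
  interpret pair_prob_space "dr_law \<nu> p n" "dr_law \<nu> p n" ..
  show ?case unfolding dr_law.simps by (rule prob_space_distr) measurable
qed

lemma nn_integral_dr_law_Suc:
  assumes "prob_space \<nu>" "sets \<nu> = sets borel" "p \<in> {0..1}"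
    and [measurable]: "f \<in> borel_measurable borel"
  shows "(\<integral>\<^sup>+ x. f x \<partial>dr_law \<nu> p (Suc n)) =
    (\<integral>\<^sup>+ x. \<integral>\<^sup>+ x'. f (max (x + x' - 1) 0) \<partial>dr_law \<nu> p n \<partial>dr_law \<nu> p n)"
proof -
  interpret prob_space "dr_law \<nu> p n" by (rule prob_space_dr_law) fact+
  have "(\<integral>\<^sup>+ x. f x \<partial>dr_law \<nu> p (Suc n)) =
      (\<integral>\<^sup>+ z. f (case z of (x, x') \<Rightarrow> max (x + x' - 1) 0) \<partial>(dr_law \<nu> p n \<Otimes>\<^sub>M dr_law \<nu> p n))"
    unfolding dr_law.simps by (rule nn_integral_distr) measurable
  also have "\<dots> = (\<integral>\<^sup>+ x. \<integral>\<^sup>+ x'. f (case (x, x') of (x, x') \<Rightarrow> max (x + x' - 1) 0) \<partial>dr_law \<nu> p n \<partial>dr_law \<nu> p n)"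
    by (rule nn_integral_fst[symmetric]) measurable
  finally show ?thesis by simp
qed

lemma mean_dr_law_Suc_le:
  assumes "prob_space \<nu>" "sets \<nu> = sets borel" "p \<in> {0..1}"
  shows "mean (dr_law \<nu> p (Suc n)) \<le> 2 * mean (dr_law \<nu> p n)"
proof -
  interpret prob_space "dr_law \<nu> p n" by (rule prob_space_dr_law) fact+
  have le: "ennreal (max (x + x' - 1) 0) \<le> ennreal x + ennreal x'" for x x' :: real
  proof -
    have "ennreal (max (x + x' - 1) 0) \<le> ennreal (max x 0 + max x' 0)"
      by (intro ennreal_leI) auto
    also have "\<dots> = ennreal x + ennreal x'"
      by (simp add: ennreal_plus max.commute[of _ 0])
    finally show ?thesis .
  qed
  have "mean (dr_law \<nu> p (Suc n)) \<le>
      (\<integral>\<^sup>+ x. \<integral>\<^sup>+ x'. ennreal x + ennreal x' \<partial>dr_law \<nu> p n \<partial>dr_law \<nu> p n)"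
    unfolding mean_def by (subst nn_integral_dr_law_Suc[OF assms]) (measurable, intro nn_integral_mono le)
  also have "\<dots> = (\<integral>\<^sup>+ x. ennreal x + mean (dr_law \<nu> p n) \<partial>dr_law \<nu> p n)"
    using emeasure_space_1 by (simp add: nn_integral_add mean_def)
  also have "\<dots> = 2 * mean (dr_law \<nu> p n)"
    using emeasure_space_1 by (simp add: nn_integral_add mean_def mult_2)
  finally show ?thesis .
qed

lemma decseq_mean_dr_law:
  assumes "prob_space \<nu>" "sets \<nu> = sets borel" "p \<in> {0..1}"
  shows "decseq (\<lambda>n. mean (dr_law \<nu> p n) / 2 ^ n)"
proof (rule decseq_SucI)
  fix n
  have "mean (dr_law \<nu> p (Suc n)) / 2 ^ Suc n \<le> (2 * mean (dr_law \<nu> p n)) / (2 * 2 ^ n)"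
    unfolding power_Suc by (rule divide_right_mono_ennreal[OF mean_dr_law_Suc_le[OF assms]])
  also have "\<dots> = mean (dr_law \<nu> p n) / 2 ^ n"
  proof -
    have "inverse (2 * 2 ^ n :: ennreal) = inverse 2 * inverse (2 ^ n)"
      by (rule ennreal_inverse_mult) (auto simp: power_less_top_ennreal)
    moreover have "(2 :: ennreal) * inverse 2 = 1"
      by (rule ennreal_divide_self[unfolded divide_ennreal_def]) auto
    ultimately show ?thesis
      unfolding divide_ennreal_def by (metis mult.assoc mult.commute mult.left_neutral)
  qed
  finally show "mean (dr_law \<nu> p (Suc n)) / 2 ^ Suc n \<le> mean (dr_law \<nu> p n) / 2 ^ n" .
qed

lemma dr_free_energy_LIMSEQ:
  assumes "prob_space \<nu>" "sets \<nu> = sets borel" "p \<in> {0..1}"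
  shows "(\<lambda>n. mean (dr_law \<nu> p n) / 2 ^ n) \<longlonglongrightarrow> dr_free_energy \<nu> p"
proof -
  note L = LIMSEQ_INF[OF decseq_mean_dr_law[OF assms]]
  show ?thesis unfolding dr_free_energy_def limI[OF L] by (rule L)
qed

lemma mono_nn_integral_dr_law:
  assumes \<nu>: "prob_space \<nu>" "sets \<nu> = sets borel" and pos: "AE x in \<nu>. 0 \<le> x"
    and p: "p \<in> {0..1}" and q: "q \<in> {0..1}" and "p \<le> q"
    and f: "mono f" "f \<in> borel_measurable borel"
  shows "(\<integral>\<^sup>+ x. f x \<partial>dr_law \<nu> p n) \<le> (\<integral>\<^sup>+ x. f x \<partial>dr_law \<nu> q n)"
  using f
proof (induction n arbitrary: f)
  case (0 f)
  interpret prob_space \<nu> by fact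
  have "f 0 = (\<integral>\<^sup>+ x. f 0 \<partial>\<nu>)" using emeasure_space_1 by simp
  also have "\<dots> \<le> (\<integral>\<^sup>+ x. f x \<partial>\<nu>)"
    by (rule nn_integral_mono_AE) (use pos in eventually_elim, auto intro: monoD 0)
  finally have le: "f 0 \<le> (\<integral>\<^sup>+ x. f x \<partial>\<nu>)" .
  have "ennreal (1 - p) * f 0 + ennreal p * (\<integral>\<^sup>+ x. f x \<partial>\<nu>)
      = ennreal (1 - q) * f 0 + ennreal (q - p) * f 0 + ennreal p * (\<integral>\<^sup>+ x. f x \<partial>\<nu>)"
    using p q \<open>p \<le> q\<close> by (simp flip: distrib_right ennreal_plus)
  also have "\<dots> \<le> ennreal (1 - q) * f 0 + ennreal (q - p) * (\<integral>\<^sup>+ x. f x \<partial>\<nu>) + ennreal p * (\<integral>\<^sup>+ x. f x \<partial>\<nu>)"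
    by (intro add_mono mult_left_mono le) auto
  also have "\<dots> = ennreal (1 - q) * f 0 + ennreal q * (\<integral>\<^sup>+ x. f x \<partial>\<nu>)"
    using p q \<open>p \<le> q\<close> by (simp add: add.assoc flip: distrib_right ennreal_plus)
  finally show ?case using 0 \<nu> by (simp add: nn_integral_dr_init)
next
  case (Suc n f)
  note [measurable] = Suc.prems(2)
  interpret P: prob_space "dr_law \<nu> p n" by (rule prob_space_dr_law) fact+
  interpret Q: prob_space "dr_law \<nu> q n" by (rule prob_space_dr_law) fact+
  have "(\<integral>\<^sup>+ x. f x \<partial>dr_law \<nu> p (Suc n)) =
    (\<integral>\<^sup>+ x. \<integral>\<^sup>+ x'. f (max (x + x' - 1) 0) \<partial>dr_law \<nu> p n \<partial>dr_law \<nu> p n)"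
    by (rule nn_integral_dr_law_Suc) fact+
  also have "\<dots> \<le> (\<integral>\<^sup>+ x. \<integral>\<^sup>+ x'. f (max (x + x' - 1) 0) \<partial>dr_law \<nu> q n \<partial>dr_law \<nu> p n)"
    by (intro nn_integral_mono Suc.IH monoI monoD[OF Suc.prems(1)]) auto
  also have "\<dots> \<le> (\<integral>\<^sup>+ x. \<integral>\<^sup>+ x'. f (max (x + x' - 1) 0) \<partial>dr_law \<nu> q n \<partial>dr_law \<nu> q n)"
    by (intro Suc.IH monoI nn_integral_mono monoD[OF Suc.prems(1)]) (auto, measurable)
  also have "\<dots> = (\<integral>\<^sup>+ x. f x \<partial>dr_law \<nu> q (Suc n))"
    by (rule nn_integral_dr_law_Suc[symmetric]) fact+
  finally show ?case .
qed

lemma mono_dr_free_energy: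
  assumes "prob_space \<nu>" "sets \<nu> = sets borel" "AE x in \<nu>. 0 \<le> x"
    and "p \<in> {0..1}" "q \<in> {0..1}" "p \<le> q"
  shows "dr_free_energy \<nu> p \<le> dr_free_energy \<nu> q"
proof (rule LIMSEQ_le[OF dr_free_energy_LIMSEQ dr_free_energy_LIMSEQ])
  have "mean (dr_law \<nu> p n) \<le> mean (dr_law \<nu> q n)" for n
    unfolding mean_def by (rule mono_nn_integral_dr_law) (use assms in \<open>auto intro: monoI ennreal_leI\<close>)
  then show "\<exists>N. \<forall>n\<ge>N. mean (dr_law \<nu> p n) / 2 ^ n \<le> mean (dr_law \<nu> q n) / 2 ^ n"
    by (auto intro!: divide_right_mono_ennreal)
qed fact+

lemma is_critical_parameter_unique:
  assumes "is_critical_parameter F c" "is_critical_parameter F d"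
  shows "c = d"
proof -
  have "\<not> a < b" if a: "is_critical_parameter F a" and b: "is_critical_parameter F b" for a b
  proof
    assume "a < b"
    then have "(a + b) / 2 \<in> {0..1}" "a < (a + b) / 2" "(a + b) / 2 < b"
      using a b by (auto simp: is_critical_parameter_def)
    then have "F ((a + b) / 2) > 0" "F ((a + b) / 2) = 0"
      using a b unfolding is_critical_parameter_def by blast+
    then show False by simp
  qed
  from this[OF assms] this[OF assms(2,1)] show ?thesis by simp
qed

lemma is_critical_parameter_ex1:
  assumes "prob_space \<nu>" "sets \<nu> = sets borel" "AE x in \<nu>. 0 \<le> x"
  shows "\<exists>!c. is_critical_parameter (dr_free_energy \<nu>) c"
proof (rule ex_ex1I)
  let ?F = "dr_free_energy \<nu>"
  define S where "S = insert 0 {p\<in>{0..1}. ?F p = 0}"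
  have S: "S \<noteq> {}" "bdd_above S" "S \<subseteq> {0..1}"
    by (auto simp: S_def intro!: bdd_aboveI[of _ 1])
  have "?F p > 0" if "p \<in> {0..1}" "p > Sup S" for p
  proof (rule ccontr)
    assume "\<not> ?F p > 0"
    then have "p \<in> S" using that by (simp add: S_def)
    then have "p \<le> Sup S" by (rule cSup_upper) fact
    with that show False by simp
  qed
  moreover have "?F p = 0" if p: "p \<in> {0..1}" "p < Sup S" for p
  proof -
    obtain q where "q \<in> S" "p < q" using less_cSupD[OF S(1) p(2)] by blast
    then have "q \<in> {0..1}" "?F q = 0" using p by (auto simp: S_def)
    then show ?thesis
      using mono_dr_free_energy[OF assms p(1), of q] \<open>p < q\<close> by simp
  qed
  moreover have "0 \<le> Sup S"
    by (rule cSup_upper[OF _ S(2)]) (simp add: S_def)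
  moreover have "Sup S \<le> 1"
    by (rule cSup_least[OF S(1)]) (use S(3) in auto)
  ultimately have "is_critical_parameter ?F (Sup S)"
    unfolding is_critical_parameter_def by simp
  then show "\<exists>c. is_critical_parameter ?F c" by blast
qed (rule is_critical_parameter_unique)

lemma is_critical_parameter_dr_critical_parameter:
  assumes "prob_space \<nu>" "sets \<nu> = sets borel" "AE x in \<nu>. 0 \<le> x"
  shows "is_critical_parameter (dr_free_energy \<nu>) (dr_critical_parameter \<nu>)"
  unfolding dr_critical_parameter_def by (rule theI'[OF is_critical_parameter_ex1[OF assms]])

end

theory Submission
  imports Defs
begin

text \<open>
  Put \<open>\<psi>\<^sub>s(k) = ((s - 1) k - 1) s\<^sup>k\<close>. It is non-decreasing, and truncation at \<open>0\<close> does not matter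
  for it: \<open>\<psi>\<^sub>s(max (k + l - 1) 0)\<close> is given by the formula for \<open>\<psi>\<^sub>s(k + l - 1)\<close> even if \<open>k = l = 0\<close>.
  So for an integer-valued \<open>X\<^sub>0\<close>, writing \<open>G\<^sub>n = E(s\<^sup>X)\<close> and \<open>H\<^sub>n = E(\<psi>\<^sub>s(X))\<close> with \<open>X = X\<^sub>n\<close>, one has
  \<open>H\<^sub>n\<^sub>+\<^sub>1 = (2/s) G\<^sub>n H\<^sub>n + (2/s - 1) G\<^sub>n\<^sup>2\<close>. In general, rounding \<open>X\<^sub>n\<close> down gives \<open>\<ge>\<close> and rounding it up
  gives \<open>\<le>\<close>.

  For \<open>s = 2\<close> and rounding up, \<open>H\<^sub>0 \<le> 0\<close> implies \<open>H\<^sub>n \<le> 0\<close> for all \<open>n\<close>, which bounds \<open>E(X\<^sub>n)\<close>, so the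
  free energy is \<open>0\<close>. If \<open>E(Y\<^sub>0 2^Y\<^sub>0)\<close> is finite, then \<open>H\<^sub>0 \<le> 0\<close> for small \<open>p\<close>.

  Conversely, if the free energy is \<open>0\<close>, then \<open>E(X\<^sub>n) \<le> 1\<close> for all \<open>n\<close>. A value \<open>X\<^sub>n \<ge> k + 2\<close> at one of
  the \<open>2\<^sup>k\<close> ancestors of \<open>X\<^sub>n\<^sub>+\<^sub>k\<close> forces \<open>X\<^sub>n\<^sub>+\<^sub>k \<ge> 2\<close>, hence \<open>P(X\<^sub>n \<ge> k + 2) \<le> 2\<^sup>-\<^sup>k\<close> uniformly in \<open>n\<close>, and for
  \<open>s < 2\<close> the rounded-down \<open>H\<^sub>n\<close> stay bounded. The recursion would make them diverge if \<open>H\<^sub>0 > 0\<close>, so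
  \<open>H\<^sub>0 \<le> 0\<close> for all \<open>s < 2\<close>, and \<open>s \<rightarrow> 2\<close> shows that \<open>E(Y\<^sub>0 2^Y\<^sub>0)\<close> is finite.
\<close>

section \<open>Auxiliary facts: the function \<open>psi\<close>, integer rounding, an elementary
  inequality\<close>

definition psi :: "real \<Rightarrow> nat \<Rightarrow> real" where
  "psi s k = ((s - 1) * real k - 1) * s ^ k"

lemma mono_psi:
  assumes "1 \<le> s"
  shows "mono (psi s)"
proof (rule mono_iff_le_Suc[THEN iffD2], intro allI)
  fix k
  have "psi s (Suc k) - psi s k = s ^ k * (s - 1)\<^sup>2 * (real k + 1)"
    by (simp add: psi_def power2_eq_square algebra_simps)
  also have "\<dots> \<ge> 0" using assms by simp
  finally show "psi s k \<le> psi s (Suc k)" by simp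
qed

text \<open>Subtraction here is truncated, and for \<open>k = l = 0\<close> both sides equal -1. On
  the right, \<open>s ^ (k + l)\<close> factorises and \<open>k + l\<close> splits, so independence
  turns expectations into products.\<close>

lemma psi_add_diff_1:
  assumes "0 < s"
  shows "psi s (k + l - 1) = (s - 1) / s * real (k + l) * s ^ (k + l) - s ^ (k + l)"
proof (cases "k + l")
  case 0
  then show ?thesis by (simp add: psi_def)
next
  case (Suc m)
  then show ?thesis using assms by (simp add: psi_def field_simps)
qed

text \<open>The floor is superadditive and commutes with subtracting 1. This and its mirror for the
  ceiling supply the hypotheses on \<open>K\<close> in the two recursions for \<open>mgf\<close> and
  \<open>wmgf\<close>.\<close>

lemma floor_pred_add_ge:
  fixes x y :: real
  assumes "0 \<le> x" "0 \<le> y"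
  shows "nat \<lfloor>x\<rfloor> + nat \<lfloor>y\<rfloor> - 1 \<le> nat \<lfloor>max (x + y - 1) 0\<rfloor>"
  using assms by linarith

lemma ceiling_pred_add_le:
  fixes x y :: real
  shows "nat \<lceil>max (x + y - 1) 0\<rceil> \<le> nat \<lceil>x\<rceil> + nat \<lceil>y\<rceil> - 1"
  by linarith

text \<open>Serves to turn a lower bound on \<open>(1 - t) ^ n\<close> into an upper bound of order
  \<open>1 / n\<close> on \<open>t\<close>.\<close>

lemma one_minus_power_mult_le_1:
  fixes t :: real
  assumes "0 \<le> t" "t \<le> 1"
  shows "(1 - t) ^ n * (1 + real n * t) \<le> 1"
proof -
  have "(1 - t) ^ n * (1 + real n * t) \<le> (1 - t) ^ n * (1 + t) ^ n"
    using assms by (intro mult_left_mono Bernoulli_inequality) auto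
  also have "\<dots> = (1 - t\<^sup>2) ^ n"
    by (simp add: power_mult_distrib[symmetric] power2_eq_square algebra_simps)
  also have "\<dots> \<le> 1"
    using assms by (intro power_le_one) (auto simp: power_le_one)
  finally show ?thesis .
qed

section \<open>Integration against the laws of the model\<close>

locale derrida_retaux =
  fixes \<nu> :: "real measure" and p :: real
  assumes prob_init: "prob_space \<nu>" and sets_init: "sets \<nu> = sets borel"
    and nonneg_init: "AE x in \<nu>. 0 \<le> x" and p: "p \<in> {0..1}"
begin

abbreviation "\<mu> \<equiv> dr_law \<nu> p"

lemma prob_space_law: "prob_space (\<mu> n)"
  by (rule prob_space_dr_law[OF prob_init sets_init p])

lemma AE_law_nonneg: "AE x in \<mu> n. 0 \<le> x"
proof (cases n)
  case 0
  have "emeasure \<nu> {..<0} = 0"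
    using nonneg_init sets_eq_imp_space_eq[OF sets_init]
    by (subst (asm) AE_iff_measurable[of "{..<0}"]) (auto simp: sets_init)
  then have "emeasure (dr_init \<nu> p) {..<0} = 0"
    by (simp add: emeasure_dr_init[OF sets_init])
  then have "AE x in dr_init \<nu> p. 0 \<le> x"
    by (subst AE_iff_measurable[of "{..<0}"]) auto
  then show ?thesis unfolding 0 dr_law.simps .
next
  case (Suc m)
  have "AE x in distr (\<mu> m \<Otimes>\<^sub>M \<mu> m) borel (\<lambda>(x, x'). max (x + x' - 1) 0). 0 \<le> x"
    by (subst AE_distr_iff) auto
  then show ?thesis unfolding Suc dr_law.simps .
qed

lemmas nn_integral_law_Suc = nn_integral_dr_law_Suc[OF prob_init sets_init p]

lemma nn_integral_law_mono:
  assumes "\<And>x. 0 \<le> x \<Longrightarrow> f x \<le> g x"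
  shows "(\<integral>\<^sup>+ x. f x \<partial>\<mu> n) \<le> (\<integral>\<^sup>+ x. g x \<partial>\<mu> n)"
  by (rule nn_integral_mono_AE) (use AE_law_nonneg in eventually_elim, rule assms)

lemma nn_integral_law_const: "(\<integral>\<^sup>+ x. c \<partial>\<mu> n) = c"
  using prob_space.emeasure_space_1[OF prob_space_law, of n] by simp

lemma nn_integral_law_add:
  assumes [measurable]: "f \<in> borel_measurable borel" "g \<in> borel_measurable borel"
  shows "(\<integral>\<^sup>+ x. \<integral>\<^sup>+ y. f x + g y \<partial>\<mu> n \<partial>\<mu> n) = (\<integral>\<^sup>+ x. f x \<partial>\<mu> n) + (\<integral>\<^sup>+ x. g x \<partial>\<mu> n)"
  using prob_space.emeasure_space_1[OF prob_space_law, of n] by (simp add: nn_integral_add)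

lemma nn_integral_law_mult:
  assumes [measurable]: "f \<in> borel_measurable borel" "g \<in> borel_measurable borel"
  shows "(\<integral>\<^sup>+ x. \<integral>\<^sup>+ y. f x * g y \<partial>\<mu> n \<partial>\<mu> n) = (\<integral>\<^sup>+ x. f x \<partial>\<mu> n) * (\<integral>\<^sup>+ x. g x \<partial>\<mu> n)"
  by (simp add: nn_integral_cmult nn_integral_multc)

section \<open>Vanishing free energy bounds all means by 1\<close>

lemma double_mean_le: "2 * mean (\<mu> n) \<le> mean (\<mu> (Suc n)) + 1"
proof -
  have "2 * mean (\<mu> n) = (\<integral>\<^sup>+ x. \<integral>\<^sup>+ y. ennreal x + ennreal y \<partial>\<mu> n \<partial>\<mu> n)"
    by (simp add: nn_integral_law_add mean_def mult_2)
  also have "\<dots> \<le> (\<integral>\<^sup>+ x. \<integral>\<^sup>+ y. ennreal (max (x + y - 1) 0) + 1 \<partial>\<mu> n \<partial>\<mu> n)"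
  proof (intro nn_integral_law_mono)
    fix x y :: real
    assume "0 \<le> x" "0 \<le> y"
    then have "ennreal x + ennreal y = ennreal (x + y)"
      by simp
    also have "\<dots> \<le> ennreal (max (x + y - 1) 0 + 1)"
      by (rule ennreal_leI) auto
    finally show "ennreal x + ennreal y \<le> ennreal (max (x + y - 1) 0) + 1"
      by simp
  qed
  also have "\<dots> = (\<integral>\<^sup>+ x. ennreal x + 1 \<partial>\<mu> (Suc n))"
    by (subst nn_integral_law_Suc) auto
  also have "\<dots> = mean (\<mu> (Suc n)) + 1"
    by (simp add: nn_integral_add nn_integral_law_const mean_def del: dr_law.simps nn_integral_const)
  finally show ?thesis .
qed

text \<open>The excess of the mean over 1 at least doubles in each generation; the inequality is
  arranged so that no subtraction occurs in \<open>ennreal\<close>.\<close>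

lemma mean_le_mean_add: "2 ^ k * mean (\<mu> n) + 1 \<le> mean (\<mu> (n + k)) + 2 ^ k"
proof (induction k)
  case (Suc k)
  have "2 ^ Suc k * mean (\<mu> n) + 1 + 1 = 2 * (2 ^ k * mean (\<mu> n) + 1)"
    by (simp add: distrib_left mult_ac add.assoc)
  also have "\<dots> \<le> 2 * (mean (\<mu> (n + k)) + 2 ^ k)"
    by (rule mult_left_mono[OF Suc]) simp
  also have "\<dots> = 2 * mean (\<mu> (n + k)) + 2 ^ Suc k"
    by (simp add: distrib_left)
  also have "\<dots> \<le> mean (\<mu> (Suc (n + k))) + 1 + 2 ^ Suc k"
    by (rule add_right_mono[OF double_mean_le])
  finally have "1 + (2 ^ Suc k * mean (\<mu> n) + 1) \<le> 1 + (mean (\<mu> (n + Suc k)) + 2 ^ Suc k)"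
    by (simp add: ac_simps)
  then show ?case
    by (simp only: ennreal_add_left_cancel_le) simp
qed simp

lemma mean_le_1_of_free_energy_eq_0:
  assumes "dr_free_energy \<nu> p = 0"
  shows "mean (\<mu> n) \<le> 1"
proof -
  have lim: "(\<lambda>k. mean (\<mu> k) / 2 ^ k) \<longlonglongrightarrow> 0"
    using dr_free_energy_LIMSEQ[OF prob_init sets_init p] assms by simp
  \<comment> \<open>This is \<open>mean_le_mean_add\<close> divided by \<open>2 ^ k\<close>. The
    bracket is a term of the sequence defining the free energy, so it tends to 0 as \<open>k\<close>
    grows.\<close>
  have *: "mean (\<mu> n) \<le> 2 ^ n * (mean (\<mu> (k + n)) / 2 ^ (k + n)) + 1" for k
  proof -
    have self: "(2 ^ k :: ennreal) * inverse (2 ^ k) = 1"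
      unfolding divide_ennreal_def[symmetric] by (rule ennreal_divide_self) (auto simp: power_less_top_ennreal)
    have self': "(2 ^ n :: ennreal) * inverse (2 ^ n) = 1"
      unfolding divide_ennreal_def[symmetric] by (rule ennreal_divide_self) (auto simp: power_less_top_ennreal)
    have inv: "inverse (2 ^ (k + n) :: ennreal) = inverse (2 ^ k) * inverse (2 ^ n)"
      unfolding power_add by (rule ennreal_inverse_mult) (auto simp: power_less_top_ennreal)
    have "mean (\<mu> n) = 2 ^ k * mean (\<mu> n) * inverse (2 ^ k)"
      using self by (metis mult.assoc mult.commute mult.left_neutral)
    also have "\<dots> \<le> (2 ^ k * mean (\<mu> n) + 1) * inverse (2 ^ k)"
      by (intro mult_right_mono) auto
    also have "\<dots> \<le> (mean (\<mu> (k + n)) + 2 ^ k) * inverse (2 ^ k)"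
      using mean_le_mean_add[of k n] by (intro mult_right_mono) (auto simp: add.commute)
    also have "\<dots> = mean (\<mu> (k + n)) * inverse (2 ^ k) + 1"
      by (simp add: distrib_right self)
    also have "mean (\<mu> (k + n)) * inverse (2 ^ k) = 2 ^ n * (mean (\<mu> (k + n)) / 2 ^ (k + n))"
      unfolding divide_ennreal_def inv using self' by (metis mult.assoc mult.commute mult.left_neutral)
    finally show ?thesis .
  qed
  have "(\<lambda>k. 2 ^ n * (mean (\<mu> (k + n)) / 2 ^ (k + n)) + 1) \<longlonglongrightarrow> 2 ^ n * 0 + 1"
    by (intro tendsto_add tendsto_const ennreal_tendsto_cmult LIMSEQ_ignore_initial_segment[OF lim])
       (auto simp: power_less_top_ennreal)
  then have "mean (\<mu> n) \<le> 2 ^ n * 0 + 1"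
    by (rule LIMSEQ_le_const) (use * in auto)
  then show ?thesis by simp
qed

section \<open>Exponential tails, uniformly over the generations\<close>

lemma emeasure_law_lessThan_Suc:
  assumes "0 < a"
  shows "emeasure (\<mu> (Suc n)) {..<a} \<le> (emeasure (\<mu> n) {..<a + 1})\<^sup>2"
proof -
  have "emeasure (\<mu> (Suc n)) {..<a} = (\<integral>\<^sup>+ x. indicator {..<a} x \<partial>\<mu> (Suc n))"
    by simp
  also have "\<dots> = (\<integral>\<^sup>+ x. \<integral>\<^sup>+ y. indicator {..<a} (max (x + y - 1) 0) \<partial>\<mu> n \<partial>\<mu> n)"
    by (rule nn_integral_law_Suc) simp
  \<comment> \<open>As both values are nonnegative, \<open>x + y - 1 < a\<close> forces each of them
    below \<open>a + 1\<close>.\<close>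
  also have "\<dots> \<le> (\<integral>\<^sup>+ x. \<integral>\<^sup>+ y. indicator {..<a + 1} x * indicator {..<a + 1} y \<partial>\<mu> n \<partial>\<mu> n)"
    by (intro nn_integral_law_mono) (auto split: split_indicator)
  also have "\<dots> = (emeasure (\<mu> n) {..<a + 1})\<^sup>2"
    by (subst nn_integral_law_mult) (auto simp: power2_eq_square)
  finally show ?thesis .
qed

lemma emeasure_law_lessThan_add:
  assumes "0 < a"
  shows "emeasure (\<mu> (n + k)) {..<a} \<le> emeasure (\<mu> n) {..<a + real k} ^ 2 ^ k"
  using assms
proof (induction k arbitrary: a)
  case (Suc k)
  have "emeasure (\<mu> (n + Suc k)) {..<a} \<le> (emeasure (\<mu> (n + k)) {..<a + 1})\<^sup>2"
    using emeasure_law_lessThan_Suc[of a "n + k"] Suc.prems by simp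
  also have "\<dots> \<le> (emeasure (\<mu> n) {..<a + 1 + real k} ^ 2 ^ k)\<^sup>2"
    using Suc.prems by (intro power_mono Suc.IH) auto
  also have "\<dots> = emeasure (\<mu> n) {..<a + real (Suc k)} ^ 2 ^ Suc k"
    by (simp add: power_mult[symmetric] mult.commute add_ac)
  finally show ?case .
qed simp

text \<open>With \<open>k = j + 2\<close> and \<open>t\<close> the tail probability, Markov's
  inequality in generation \<open>n + j\<close> at level 2 gives
  \<open>1 / 2 <= (1 - t) ^ 2 ^ j\<close>, since all \<open>2 ^ j\<close> ancestors must stay below
  \<open>2 + j\<close>. The factor 4 compensates the shift by 2.\<close>

lemma tail_law_le:
  assumes "\<And>n. mean (\<mu> n) \<le> 1"
  shows "measure (\<mu> n) {real k..} \<le> 4 * (1 / 2) ^ k"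
proof (cases "k \<le> 2")
  case True
  interpret prob_space "\<mu> n" by (rule prob_space_law)
  \<comment> \<open>For \<open>k <= 2\<close> the claimed bound is at least 1.\<close>
  have "measure (\<mu> n) {real k..} \<le> 4 * (1 / 2)\<^sup>2"
    by (simp add: power2_eq_square)
  also have "\<dots> \<le> 4 * (1 / 2) ^ k"
    using True by (intro mult_left_mono power_decreasing) auto
  finally show ?thesis .
next
  case False
  define j where "j = k - 2"
  have k: "real k = 2 + real j" "k = j + 2" using False by (auto simp: j_def)
  interpret prob_space "\<mu> n" by (rule prob_space_law)
  interpret N: prob_space "\<mu> (n + j)" by (rule prob_space_law)
  define t where "t = prob {real k..}"
  have t: "0 \<le> t" "t \<le> 1" by (auto simp: t_def)
  have compl: "UNIV - {..<a} = {a..}" for a :: real by auto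
  have "2 * emeasure (\<mu> (n + j)) {2..} = (\<integral>\<^sup>+ x. 2 * indicator {2..} x \<partial>\<mu> (n + j))"
    by (simp add: nn_integral_cmult)
  also have "\<dots> \<le> mean (\<mu> (n + j))"
    unfolding mean_def by (intro nn_integral_mono) (auto split: split_indicator intro: ennreal_leI simp: ennreal_numeral[symmetric] simp del: ennreal_numeral)
  also have "\<dots> \<le> 1" by (rule assms)
  finally have "ennreal (2 * N.prob {2..}) \<le> ennreal 1"
    by (simp add: N.emeasure_eq_measure ennreal_mult)
  then have "N.prob {2..} \<le> 1 / 2"
    by (subst (asm) ennreal_le_iff) auto
  then have "1 / 2 \<le> N.prob {..<2}"
    using N.prob_compl[of "{..<2}"] compl[of 2] by simp
  also have "\<dots> \<le> prob {..<2 + real j} ^ 2 ^ j"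
    using emeasure_law_lessThan_add[of 2 n j]
    by (simp add: emeasure_eq_measure N.emeasure_eq_measure ennreal_power)
  also have "\<dots> = (1 - t) ^ 2 ^ j"
    using prob_compl[of "{..<2 + real j}"] compl[of "2 + real j"] by (simp add: t_def k)
  finally have "1 / 2 * (1 + real (2 ^ j) * t) \<le> (1 - t) ^ 2 ^ j * (1 + real (2 ^ j) * t)"
    using t by (intro mult_right_mono) auto
  also have "\<dots> \<le> 1"
    by (rule one_minus_power_mult_le_1[OF t])
  finally have "t * 2 ^ j \<le> 1" by (simp add: mult.commute)
  then have "t \<le> 1 / 2 ^ j" by (simp add: field_simps)
  then show ?thesis
    unfolding t_def k(2) by (simp add: power_divide)
qed

section \<open>Generating functions of the rounded variables and the lower recursion\<close>

text \<open>Both sides of the integrated \<open>psi\<close> inequalities have this shape: products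
  in the two copies plus a term in the next generation. A missing product is filled in as
  \<open>0 * 0\<close>.\<close>

lemma nn_integral_law_products_add_Suc:
  assumes [measurable]: "u \<in> borel_measurable borel" "v \<in> borel_measurable borel"
    "u' \<in> borel_measurable borel" "v' \<in> borel_measurable borel" "f \<in> borel_measurable borel"
  shows "(\<integral>\<^sup>+ x. \<integral>\<^sup>+ y. u x * v y + u' x * v' y + f (max (x + y - 1) 0) \<partial>\<mu> n \<partial>\<mu> n) =
    (\<integral>\<^sup>+ x. u x \<partial>\<mu> n) * (\<integral>\<^sup>+ x. v x \<partial>\<mu> n) + (\<integral>\<^sup>+ x. u' x \<partial>\<mu> n) * (\<integral>\<^sup>+ x. v' x \<partial>\<mu> n) +
    (\<integral>\<^sup>+ x. f x \<partial>\<mu> (Suc n))"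
proof -
  interpret prob_space "\<mu> n" by (rule prob_space_law)
  show ?thesis
    by (subst nn_integral_law_Suc)
       (simp_all add: nn_integral_add nn_integral_cmult nn_integral_multc)
qed

text \<open>\<open>K\<close> stands for rounding down or up. In the notation of the overview
  \<open>mgf\<close> is \<open>G_n\<close>, and \<open>H_n\<close> is
  \<open>(s - 1) * wmgf - mgf\<close>; the two parts are kept apart because \<open>psi\<close> takes
  negative values while the integral is in \<open>ennreal\<close>.\<close>

definition mgf :: "(real \<Rightarrow> nat) \<Rightarrow> real \<Rightarrow> nat \<Rightarrow> ennreal" where
  "mgf K s n = (\<integral>\<^sup>+ x. ennreal (s ^ K x) \<partial>\<mu> n)"

definition wmgf :: "(real \<Rightarrow> nat) \<Rightarrow> real \<Rightarrow> nat \<Rightarrow> ennreal" where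
  "wmgf K s n = (\<integral>\<^sup>+ x. ennreal (real (K x) * s ^ K x) \<partial>\<mu> n)"

text \<open>This is \<open>H_(n+1) >= (2/s) G_n H_n + (2/s - 1) G_n^2\<close> with every negative
  term moved across. It integrates the pointwise bound
  \<open>psi s (K x + K y - 1) <= psi s (K (max (x + y - 1) 0))\<close>, which holds by monotonicity
  of \<open>psi\<close>.\<close>

lemma mgf_wmgf_recursion_ge:
  assumes s: "1 \<le> s" and [measurable]: "K \<in> borel \<rightarrow>\<^sub>M count_space UNIV"
    and K: "\<And>x y. 0 \<le> x \<Longrightarrow> 0 \<le> y \<Longrightarrow> K x + K y - 1 \<le> K (max (x + y - 1) 0)"
  shows "ennreal (2 * (s - 1) / s) * (wmgf K s n * mgf K s n) + mgf K s (Suc n)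
    \<le> (mgf K s n)\<^sup>2 + ennreal (s - 1) * wmgf K s (Suc n)"
proof -
  let ?c = "(s - 1) / s"
  let ?u = "\<lambda>x. ennreal (?c * (real (K x) * s ^ K x))"
  let ?v = "\<lambda>x. ennreal (s ^ K x)"
  let ?w = "\<lambda>x. ennreal ((s - 1) * (real (K x) * s ^ K x))"
  have u: "(\<integral>\<^sup>+ x. ?u x \<partial>\<mu> n) = ennreal ?c * wmgf K s n"
    unfolding wmgf_def using s by (subst nn_integral_cmult[symmetric]) (auto simp: ennreal_mult'[symmetric])
  have w: "(\<integral>\<^sup>+ x. ?w x \<partial>\<mu> (Suc n)) = ennreal (s - 1) * wmgf K s (Suc n)"
    unfolding wmgf_def using s by (subst nn_integral_cmult[symmetric]) (auto simp: ennreal_mult'[symmetric])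
  have "ennreal (2 * (s - 1) / s) = ennreal ?c + ennreal ?c"
    using s by (simp add: field_simps flip: ennreal_plus)
  then have "ennreal (2 * (s - 1) / s) * (wmgf K s n * mgf K s n) + mgf K s (Suc n) =
      (\<integral>\<^sup>+ x. ?u x \<partial>\<mu> n) * (\<integral>\<^sup>+ x. ?v x \<partial>\<mu> n) + (\<integral>\<^sup>+ x. ?v x \<partial>\<mu> n) * (\<integral>\<^sup>+ x. ?u x \<partial>\<mu> n) +
      (\<integral>\<^sup>+ x. ?v x \<partial>\<mu> (Suc n))"
    unfolding u mgf_def[symmetric] by (simp only: distrib_left distrib_right ac_simps)
  also have "\<dots> = (\<integral>\<^sup>+ x. \<integral>\<^sup>+ y. ?u x * ?v y + ?v x * ?u y + ?v (max (x + y - 1) 0) \<partial>\<mu> n \<partial>\<mu> n)"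
    by (rule nn_integral_law_products_add_Suc[symmetric]) measurable
  also have "\<dots> \<le> (\<integral>\<^sup>+ x. \<integral>\<^sup>+ y. ?v x * ?v y + 0 * 0 + ?w (max (x + y - 1) 0) \<partial>\<mu> n \<partial>\<mu> n)"
  proof (intro nn_integral_law_mono)
    fix x y :: real
    assume "0 \<le> x" "0 \<le> y"
    define k l m where "k = K x" "l = K y" "m = K (max (x + y - 1) 0)"
    have "psi s (k + l - 1) \<le> psi s m"
      using K[OF \<open>0 \<le> x\<close> \<open>0 \<le> y\<close>] by (intro monoD[OF mono_psi[OF s]]) (simp add: k_l_m_def)
    then have le: "?c * (real k * s ^ k) * s ^ l + s ^ k * (?c * (real l * s ^ l)) + s ^ m
        \<le> s ^ k * s ^ l + 0 * 0 + (s - 1) * (real m * s ^ m)"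
      using s by (subst (asm) psi_add_diff_1)
        (auto simp: psi_def power_add algebra_simps add_divide_distrib diff_divide_distrib)
    define u v w where "u k = ?c * (real k * s ^ k)" "v k = s ^ k" "w k = (s - 1) * (real k * s ^ k)" for k
    have nonneg: "0 \<le> u k" "0 \<le> v k" "0 \<le> w k" for k using s by (auto simp: u_v_w_def)
    have "ennreal (u k * v l + v k * u l + v m) \<le> ennreal (v k * v l + 0 * 0 + w m)"
      using le unfolding u_v_w_def by (rule ennreal_leI)
    then have "ennreal (u k) * ennreal (v l) + ennreal (v k) * ennreal (u l) + ennreal (v m)
        \<le> ennreal (v k) * ennreal (v l) + 0 * 0 + ennreal (w m)"
      using nonneg by (simp add: ennreal_mult)
    then show "?u x * ?v y + ?v x * ?u y + ?v (max (x + y - 1) 0)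
        \<le> ?v x * ?v y + 0 * 0 + ?w (max (x + y - 1) 0)"
      by (simp only: u_v_w_def k_l_m_def)
  qed
  also have "\<dots> = (\<integral>\<^sup>+ x. ?v x \<partial>\<mu> n) * (\<integral>\<^sup>+ x. ?v x \<partial>\<mu> n) + (\<integral>\<^sup>+ x. 0 \<partial>\<mu> n) * (\<integral>\<^sup>+ x. 0 \<partial>\<mu> n) +
      (\<integral>\<^sup>+ x. ?w x \<partial>\<mu> (Suc n))"
    by (rule nn_integral_law_products_add_Suc) measurable
  also have "\<dots> = (mgf K s n)\<^sup>2 + ennreal (s - 1) * wmgf K s (Suc n)"
    unfolding w by (simp add: mgf_def power2_eq_square)
  finally show ?thesis .
qed

section \<open>Necessity: the sign of \<open>H_0\<close> for \<open>s < 2\<close>, then the limit at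
  2\<close>

text \<open>Tails of order \<open>2 ^ -k\<close> beat the weights \<open>k * s ^ k\<close> when
  \<open>s < 2\<close>, with a bound independent of the generation.\<close>

lemma wmgf_floor_bounded:
  assumes mean: "\<And>n. mean (\<mu> n) \<le> 1" and s: "1 \<le> s" "s < 2"
  shows "\<exists>C\<ge>0. \<forall>n. wmgf (\<lambda>x. nat \<lfloor>x\<rfloor>) s n \<le> ennreal C"
proof -
  define f where "f k = real k * s ^ k" for k
  define g where "g k = f k * (4 * (1 / 2) ^ k)" for k
  have f: "0 \<le> f k" for k using s by (simp add: f_def)
  then have g: "0 \<le> g k" for k by (simp add: g_def)
  have sum: "summable (\<lambda>k. 4 * (real (Suc k) * (s / 2) ^ k))"
    using geometric_deriv_sums[of "s / 2"] s by (intro summable_mult) (auto dest: sums_summable)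
  have "summable g"
  proof (rule summable_comparison_test'[OF sum])
    fix k :: nat
    have "g k = 4 * (real k * (s / 2) ^ k)"
      by (simp add: g_def f_def power_divide)
    also have "\<dots> \<le> 4 * (real (Suc k) * (s / 2) ^ k)"
      using s by (intro mult_left_mono mult_right_mono) auto
    finally show "norm (g k) \<le> 4 * (real (Suc k) * (s / 2) ^ k)" using g[of k] by simp
  qed
  have "wmgf (\<lambda>x. nat \<lfloor>x\<rfloor>) s n \<le> ennreal (suminf g)" for n
  proof -
    interpret prob_space "\<mu> n" by (rule prob_space_law)
    \<comment> \<open>A crude but sufficient bound: the value at \<open>x\<close> is the single term
      with \<open>k\<close> the floor of \<open>x\<close>, and all terms with \<open>k <= x\<close>
      are added.\<close>
    have "wmgf (\<lambda>x. nat \<lfloor>x\<rfloor>) s n \<le> (\<integral>\<^sup>+ x. (\<Sum>k. ennreal (f k) * indicator {real k..} x) \<partial>\<mu> n)"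
      unfolding wmgf_def
    proof (rule nn_integral_law_mono)
      fix x :: real
      assume "0 \<le> x"
      then have "ennreal (real (nat \<lfloor>x\<rfloor>) * s ^ nat \<lfloor>x\<rfloor>) = (\<Sum>k\<in>{nat \<lfloor>x\<rfloor>}. ennreal (f k) * indicator {real k..} x)"
        by (simp add: f_def)
      also have "\<dots> \<le> (\<Sum>k. ennreal (f k) * indicator {real k..} x)"
        by (rule sum_le_suminf) auto
      finally show "ennreal (real (nat \<lfloor>x\<rfloor>) * s ^ nat \<lfloor>x\<rfloor>) \<le> \<dots>" .
    qed
    also have "\<dots> = (\<Sum>k. ennreal (f k) * emeasure (\<mu> n) {real k..})"
      by (simp add: nn_integral_suminf nn_integral_cmult)
    also have "\<dots> \<le> (\<Sum>k. ennreal (g k))"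
    proof (rule suminf_le)
      fix k
      show "ennreal (f k) * emeasure (\<mu> n) {real k..} \<le> ennreal (g k)"
        using f[of k] tail_law_le[OF mean, of n k]
        by (auto simp: emeasure_eq_measure g_def ennreal_mult[symmetric] intro!: ennreal_leI mult_left_mono)
    qed auto
    also have "\<dots> = ennreal (suminf g)"
      by (rule suminf_ennreal2[OF g \<open>summable g\<close>])
    finally show ?thesis .
  qed
  moreover have "0 \<le> suminf g" by (rule suminf_nonneg[OF \<open>summable g\<close> g])
  ultimately show ?thesis by blast
qed

lemma mgf_ge_1: "1 \<le> s \<Longrightarrow> 1 \<le> mgf K s n"
  using nn_integral_mono[of "\<mu> n" "\<lambda>_. 1" "\<lambda>x. ennreal (s ^ K x)"]
  by (simp add: mgf_def nn_integral_law_const del: nn_integral_const)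

lemma mgf_le_Suc_wmgf:
  assumes "1 \<le> s" and [measurable]: "K \<in> borel \<rightarrow>\<^sub>M count_space UNIV"
  shows "mgf K s n \<le> 1 + wmgf K s n"
proof -
  have "mgf K s n \<le> (\<integral>\<^sup>+ x. 1 + ennreal (real (K x) * s ^ K x) \<partial>\<mu> n)"
    unfolding mgf_def
  proof (rule nn_integral_mono)
    fix x
    have "s ^ K x \<le> 1 + real (K x) * s ^ K x"
      using assms(1) by (cases "K x") (auto simp: algebra_simps)
    from ennreal_leI[OF this] show "ennreal (s ^ K x) \<le> 1 + ennreal (real (K x) * s ^ K x)"
      using assms(1) by simp
  qed
  also have "\<dots> = 1 + wmgf K s n"
    by (simp add: nn_integral_add nn_integral_law_const wmgf_def del: nn_integral_const)
  finally show ?thesis .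
qed

text \<open>The claim is \<open>H_0 <= 0\<close>. Everything is finite, so the recursion can be run
  in the reals, where a positive start would make \<open>H_n\<close> grow at least linearly against
  a uniform upper bound.\<close>

lemma wmgf_floor_le_mgf_floor_of_mean_le_1:
  assumes mean: "\<And>n. mean (\<mu> n) \<le> 1" and s: "1 \<le> s" "s < 2"
  shows "ennreal (s - 1) * wmgf (\<lambda>x. nat \<lfloor>x\<rfloor>) s 0 \<le> mgf (\<lambda>x. nat \<lfloor>x\<rfloor>) s 0"
proof -
  let ?K = "\<lambda>x :: real. nat \<lfloor>x\<rfloor>"
  obtain C where C: "0 \<le> C" "wmgf ?K s n \<le> ennreal C" for n
    using wmgf_floor_bounded[OF mean s] by blast
  define a b where "a n = enn2real (wmgf ?K s n)" "b n = enn2real (mgf ?K s n)" for n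
  have fin: "wmgf ?K s n < top" for n
    using C(2)[of n] by (auto simp: top_unique less_top[symmetric])
  have fin': "mgf ?K s n < top" for n
    using mgf_le_Suc_wmgf[OF s(1), of ?K n] fin[of n] by (auto simp: top_unique less_top[symmetric])
  have a: "wmgf ?K s n = ennreal (a n)" "0 \<le> a n" for n
    using fin[of n] by (auto simp: a_b_def)
  have b: "mgf ?K s n = ennreal (b n)" "0 \<le> b n" for n
    using fin'[of n] by (auto simp: a_b_def)
  have b1: "1 \<le> b n" for n
    using mgf_ge_1[OF s(1), of ?K n] b(2)[of n] unfolding b(1) by simp
  have aC: "a n \<le> C" for n
    using C(2)[of n] C(1) unfolding a(1) by simp
  define h where "h n = (s - 1) * a n - b n" for n
  have rec: "2 / s * b n * h n + (2 / s - 1) * (b n)\<^sup>2 \<le> h (Suc n)" for n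
  proof -
    have "ennreal (2 * (s - 1) / s) * (ennreal (a n) * ennreal (b n)) + ennreal (b (Suc n))
        \<le> (ennreal (b n))\<^sup>2 + ennreal (s - 1) * ennreal (a (Suc n))"
      using mgf_wmgf_recursion_ge[OF s(1), of ?K n] floor_pred_add_ge unfolding a(1) b(1) by simp
    moreover have "ennreal (2 * (s - 1) / s * (a n * b n) + b (Suc n))
        = ennreal (2 * (s - 1) / s) * (ennreal (a n) * ennreal (b n)) + ennreal (b (Suc n))"
      using s a(2) b(2) by (subst ennreal_plus) (auto simp: ennreal_mult'[symmetric])
    moreover have "ennreal ((b n)\<^sup>2 + (s - 1) * a (Suc n)) = (ennreal (b n))\<^sup>2 + ennreal (s - 1) * ennreal (a (Suc n))"
      using s a(2) b(2) by (subst ennreal_plus) (auto simp: ennreal_mult' ennreal_power)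
    ultimately have "ennreal (2 * (s - 1) / s * (a n * b n) + b (Suc n)) \<le> ennreal ((b n)\<^sup>2 + (s - 1) * a (Suc n))"
      by metis
    then have "2 * (s - 1) / s * (a n * b n) + b (Suc n) \<le> (b n)\<^sup>2 + (s - 1) * a (Suc n)"
      using s a(2)[of "Suc n"] by (subst (asm) ennreal_le_iff) auto
    moreover have "2 / s * b n * h n + (2 / s - 1) * (b n)\<^sup>2 = 2 * (s - 1) / s * (a n * b n) - (b n)\<^sup>2"
      using s by (simp add: h_def field_simps power2_eq_square)
    ultimately show ?thesis by (simp add: h_def)
  qed
  have "h 0 \<le> 0"
  proof (rule ccontr)
    assume "\<not> h 0 \<le> 0"
    \<comment> \<open>The guaranteed increment per generation: \<open>b n >= 1\<close> and
      \<open>2 / s >= 1\<close> give \<open>h (Suc n) >= h n + d\<close>. It is positive because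
      \<open>s < 2\<close>.\<close>
    define d where "d = 2 / s - 1"
    have d: "0 < d" using s by (simp add: d_def)
    have lower: "real n * d \<le> h n" for n
    proof (induction n)
      case (Suc n)
      have h: "0 \<le> h n" using Suc d by (meson mult_nonneg_nonneg of_nat_0_le_iff less_imp_le order_trans)
      have "1 * 1 * h n \<le> 2 / s * b n * h n"
        using s b1[of n] h by (intro mult_right_mono mult_mono) auto
      moreover have "d * 1 \<le> d * (b n)\<^sup>2"
        using b1[of n] d by (intro mult_left_mono) auto
      ultimately have "h n + d \<le> h (Suc n)" using rec[of n] by (simp add: d_def)
      then show ?case using Suc by (simp add: algebra_simps)
    qed (use \<open>\<not> h 0 \<le> 0\<close> in simp)
    have upper: "h n \<le> C" for n
    proof -
      have "(s - 1) * a n \<le> 1 * C" using s aC[of n] a(2)[of n] by (intro mult_mono) auto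
      then show ?thesis using b(2)[of n] by (simp add: h_def)
    qed
    obtain n where "C < real n * d"
      using reals_Archimedean3[OF d, rule_format, of C] by blast
    then show False using lower[of n] upper[of n] by simp
  qed
  then show ?thesis
    unfolding a(1) b(1) using s a(2)[of 0] by (simp add: h_def ennreal_mult[symmetric] ennreal_leI)
qed

lemma wmgf_floor_2_le_of_free_energy_eq_0:
  assumes "dr_free_energy \<nu> p = 0"
  shows "wmgf (\<lambda>x. nat \<lfloor>x\<rfloor>) 2 0 \<le> 11"
proof -
  let ?K = "\<lambda>x :: real. nat \<lfloor>x\<rfloor>"
  note mean = mean_le_1_of_free_energy_eq_0[OF assms]
  have bound: "wmgf ?K s 0 \<le> 11" if s: "5 / 3 \<le> s" "s < 2" for s
  proof -
    \<comment> \<open>That is, \<open>k * s ^ k <= 3 * psi s k + 11\<close>. For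
      \<open>k <= 2\<close> the left side is at most 8 and \<open>psi s k >= psi s 0 = -1\<close>;
      for \<open>k >= 3\<close> the choice \<open>s >= 5 / 3\<close> already gives it without the
      constant. Integrated with \<open>H_0 <= 0\<close>, it bounds \<open>wmgf\<close> by 11
      uniformly in \<open>s\<close>.\<close>
    have pw: "real k * s ^ k + 3 * s ^ k \<le> 3 * ((s - 1) * (real k * s ^ k)) + 11" for k
    proof (cases "k \<le> 2")
      case True
      have "psi s 0 \<le> psi s k"
        using s by (intro monoD[OF mono_psi]) auto
      moreover have "real k * s ^ k \<le> 2 * 2\<^sup>2"
      proof (rule mult_mono)
        have "s ^ k \<le> 2 ^ k" using s by (intro power_mono) auto
        also have "\<dots> \<le> 2\<^sup>2" using True by (intro power_increasing) auto
        finally show "s ^ k \<le> 2\<^sup>2" .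
      qed (use True s in auto)
      ultimately show ?thesis by (simp add: psi_def algebra_simps)
    next
      case False
      have "5 / 3 * real k \<le> s * real k" using s by (intro mult_right_mono) auto
      moreover have "3 \<le> real k" using False by simp
      ultimately have "0 \<le> 3 * (s * real k) - 3 - 4 * real k" by linarith
      then have "0 \<le> (3 * (s * real k) - 3 - 4 * real k) * s ^ k"
        using s by (intro mult_nonneg_nonneg) auto
      then show ?thesis by (simp add: algebra_simps)
    qed
    \<comment> \<open>Finiteness allows \<open>3 * mgf\<close> to be cancelled from both sides at
      the end.\<close>
    have fin: "mgf ?K s 0 \<noteq> top"
    proof -
      obtain C where "\<And>n. wmgf ?K s n \<le> ennreal C"
        using wmgf_floor_bounded[OF mean, of s] s by auto
      then have "wmgf ?K s 0 < top" by (metis ennreal_less_top le_less_trans)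
      then show ?thesis
        using mgf_le_Suc_wmgf[of s ?K 0] s by (auto simp: top_unique)
    qed
    have "3 * mgf ?K s 0 + wmgf ?K s 0 = (\<integral>\<^sup>+ x. ennreal (real (?K x) * s ^ ?K x + 3 * s ^ ?K x) \<partial>\<mu> 0)"
      using s by (simp add: mgf_def wmgf_def nn_integral_add nn_integral_cmult ennreal_mult add.commute del: dr_law.simps)
    also have "\<dots> \<le> (\<integral>\<^sup>+ x. ennreal (3 * ((s - 1) * (real (?K x) * s ^ ?K x)) + 11) \<partial>\<mu> 0)"
      by (intro nn_integral_mono ennreal_leI pw)
    also have "\<dots> = 3 * (ennreal (s - 1) * wmgf ?K s 0) + 11"
      using s by (simp add: mgf_def wmgf_def nn_integral_add nn_integral_cmult ennreal_mult
          nn_integral_law_const del: dr_law.simps nn_integral_const)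
    also have "\<dots> \<le> 3 * mgf ?K s 0 + 11"
      using s by (intro add_right_mono mult_left_mono wmgf_floor_le_mgf_floor_of_mean_le_1[OF mean]) auto
    finally show ?thesis
      using fin by (simp add: ennreal_add_left_cancel_le ennreal_mult_eq_top_iff)
  qed
  \<comment> \<open>The offset 3 makes the sequence start at \<open>5 / 3\<close>, the lower end of
    the admissible range.\<close>
  define s where "s i = 2 - inverse (real (i + 3))" for i
  have s: "5 / 3 \<le> s i" "s i < 2" for i
    by (simp_all add: s_def field_simps)
  have lim: "s \<longlonglongrightarrow> 2"
    unfolding s_def using tendsto_diff[OF tendsto_const LIMSEQ_ignore_initial_segment[OF lim_inverse_n], of "2 :: real" 3]
    by simp
  \<comment> \<open>Fatou's lemma carries the uniform bound over to \<open>s = 2\<close>.\<close>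
  have "wmgf ?K 2 0 = (\<integral>\<^sup>+ x. liminf (\<lambda>i. ennreal (real (?K x) * s i ^ ?K x)) \<partial>\<mu> 0)"
    unfolding wmgf_def
  proof (intro nn_integral_cong lim_imp_Liminf[symmetric])
    fix x
    show "(\<lambda>i. ennreal (real (?K x) * s i ^ ?K x)) \<longlonglongrightarrow> ennreal (real (?K x) * 2 ^ ?K x)"
      by (intro tendsto_intros lim)
  qed auto
  also have "\<dots> \<le> liminf (\<lambda>i. wmgf ?K (s i) 0)"
    unfolding wmgf_def by (rule nn_integral_liminf) (simp del: dr_law.simps)
  also have "\<dots> \<le> liminf (\<lambda>i. 11)"
    by (intro Liminf_mono always_eventually allI bound s)
  finally show ?thesis by (simp add: Liminf_const)
qed

text \<open>The initial law contains \<open>\<nu>\<close> with weight \<open>p > 0\<close>, and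
  passing from \<open>x\<close> to its floor changes \<open>x * 2 powr x\<close> by bounded factors
  and constants only.\<close>

lemma free_energy_eq_0_imp_finite:
  assumes "dr_free_energy \<nu> p = 0" "0 < p"
  shows "(\<integral>\<^sup>+ x. ennreal (x * 2 powr x) \<partial>\<nu>) < \<infinity>"
proof -
  let ?K = "\<lambda>x :: real. nat \<lfloor>x\<rfloor>"
  have [measurable_cong]: "sets \<nu> = sets borel" by (rule sets_init)
  have pw: "x * 2 powr x \<le> 2 + 4 * (real (?K x) * 2 ^ ?K x)" if "0 \<le> x" for x
  proof -
    define k where "k = ?K x"
    have k: "x \<le> real (k + 1)" using that unfolding k_def by linarith
    have "x * 2 powr x \<le> real (k + 1) * 2 powr real (k + 1)"
      using that k by (intro mult_mono powr_mono) auto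
    also have "\<dots> = 2 * (real k + 1) * 2 ^ k"
      by (simp add: powr_realpow[of 2 "k + 1", simplified] powr_add powr_realpow)
    also have "\<dots> \<le> 2 + 4 * (real k * 2 ^ k)"
      by (cases k) (auto simp: algebra_simps)
    finally show ?thesis by (simp add: k_def)
  qed
  have "ennreal p * (\<integral>\<^sup>+ x. ennreal (x * 2 powr x) \<partial>\<nu>) \<le> (\<integral>\<^sup>+ x. ennreal (x * 2 powr x) \<partial>\<mu> 0)"
    by (simp add: nn_integral_dr_init[OF sets_init])
  also have "\<dots> \<le> (\<integral>\<^sup>+ x. ennreal (2 + 4 * (real (?K x) * 2 ^ ?K x)) \<partial>\<mu> 0)"
    by (intro nn_integral_law_mono ennreal_leI pw)
  also have "\<dots> = 2 + 4 * wmgf ?K 2 0"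
    by (simp add: wmgf_def nn_integral_add nn_integral_cmult ennreal_mult
          nn_integral_law_const del: dr_law.simps nn_integral_const)
  also have "\<dots> \<le> 2 + 4 * 11"
    by (intro add_left_mono mult_left_mono wmgf_floor_2_le_of_free_energy_eq_0 assms) auto
  also have "\<dots> < \<infinity>" by simp
  finally show ?thesis using \<open>0 < p\<close>
    by (auto simp: ennreal_mult_less_top)
qed

section \<open>Sufficiency: the upper recursion at \<open>s = 2\<close>\<close>

text \<open>At \<open>s = 2\<close> the term with \<open>2/s - 1\<close> vanishes, leaving
  \<open>H_(n+1) <= G_n H_n\<close>, again without subtraction. The weight \<open>1 / 2\<close>
  below is \<open>(s - 1) / s\<close>.\<close>

lemma mgf_wmgf_recursion_le:
  assumes [measurable]: "K \<in> borel \<rightarrow>\<^sub>M count_space UNIV"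
    and K: "\<And>x y. 0 \<le> x \<Longrightarrow> 0 \<le> y \<Longrightarrow> K (max (x + y - 1) 0) \<le> K x + K y - 1"
  shows "(mgf K 2 n)\<^sup>2 + wmgf K 2 (Suc n) \<le> wmgf K 2 n * mgf K 2 n + mgf K 2 (Suc n)"
proof -
  let ?u = "\<lambda>x. ennreal (1 / 2 * (real (K x) * 2 ^ K x))"
  let ?v = "\<lambda>x. ennreal (2 ^ K x)"
  let ?w = "\<lambda>x. ennreal (real (K x) * 2 ^ K x)"
  have u: "(\<integral>\<^sup>+ x. ?u x \<partial>\<mu> n) = ennreal (1 / 2) * wmgf K 2 n"
    unfolding wmgf_def by (subst nn_integral_cmult[symmetric]) (auto simp: ennreal_mult'[symmetric] simp del: ennreal_half)
  have half: "ennreal (1 / 2) + ennreal (1 / 2) = 1"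
    by (simp flip: ennreal_plus del: ennreal_half)
  have "(mgf K 2 n)\<^sup>2 + wmgf K 2 (Suc n) =
      (\<integral>\<^sup>+ x. ?v x \<partial>\<mu> n) * (\<integral>\<^sup>+ x. ?v x \<partial>\<mu> n) + (\<integral>\<^sup>+ x. 0 \<partial>\<mu> n) * (\<integral>\<^sup>+ x. 0 \<partial>\<mu> n) +
      (\<integral>\<^sup>+ x. ?w x \<partial>\<mu> (Suc n))"
    by (simp add: mgf_def wmgf_def power2_eq_square)
  also have "\<dots> = (\<integral>\<^sup>+ x. \<integral>\<^sup>+ y. ?v x * ?v y + 0 * 0 + ?w (max (x + y - 1) 0) \<partial>\<mu> n \<partial>\<mu> n)"
    by (rule nn_integral_law_products_add_Suc[symmetric]) measurable
  also have "\<dots> \<le> (\<integral>\<^sup>+ x. \<integral>\<^sup>+ y. ?u x * ?v y + ?v x * ?u y + ?v (max (x + y - 1) 0) \<partial>\<mu> n \<partial>\<mu> n)"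
  proof (intro nn_integral_law_mono)
    fix x y :: real
    assume "0 \<le> x" "0 \<le> y"
    define k l m where "k = K x" "l = K y" "m = K (max (x + y - 1) 0)"
    have "psi 2 m \<le> psi 2 (k + l - 1)"
      using K[OF \<open>0 \<le> x\<close> \<open>0 \<le> y\<close>] by (intro monoD[OF mono_psi]) (simp_all add: k_l_m_def)
    then have "2 ^ k * 2 ^ l + 0 * 0 + real m * 2 ^ m
        \<le> 1 / 2 * (real k * 2 ^ k) * 2 ^ l + 2 ^ k * (1 / 2 * (real l * 2 ^ l)) + 2 ^ m"
      by (subst (asm) psi_add_diff_1) (auto simp: psi_def power_add algebra_simps)
    from ennreal_leI[OF this] show "?v x * ?v y + 0 * 0 + ?w (max (x + y - 1) 0)
        \<le> ?u x * ?v y + ?v x * ?u y + ?v (max (x + y - 1) 0)"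
      by (simp add: ennreal_mult'[symmetric] flip: k_l_m_def ennreal_plus)
  qed
  also have "\<dots> = (\<integral>\<^sup>+ x. ?u x \<partial>\<mu> n) * (\<integral>\<^sup>+ x. ?v x \<partial>\<mu> n) + (\<integral>\<^sup>+ x. ?v x \<partial>\<mu> n) * (\<integral>\<^sup>+ x. ?u x \<partial>\<mu> n) +
      (\<integral>\<^sup>+ x. ?v x \<partial>\<mu> (Suc n))"
    by (rule nn_integral_law_products_add_Suc) measurable
  also have "\<dots> = (ennreal (1 / 2) + ennreal (1 / 2)) * (wmgf K 2 n * mgf K 2 n) + mgf K 2 (Suc n)"
    unfolding u mgf_def[symmetric] by (simp only: distrib_left distrib_right ac_simps)
  finally show ?thesis unfolding half by simp
qed

text \<open>Propagates finiteness of \<open>mgf\<close> through the generations, which cancellation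
  in \<open>ennreal\<close> requires.\<close>

lemma mgf_2_Suc_le:
  assumes [measurable]: "K \<in> borel \<rightarrow>\<^sub>M count_space UNIV"
    and K: "\<And>x y. 0 \<le> x \<Longrightarrow> 0 \<le> y \<Longrightarrow> K (max (x + y - 1) 0) \<le> K x + K y - 1"
  shows "mgf K 2 (Suc n) \<le> (mgf K 2 n)\<^sup>2"
proof -
  have "mgf K 2 (Suc n) = (\<integral>\<^sup>+ x. \<integral>\<^sup>+ y. ennreal (2 ^ K (max (x + y - 1) 0)) \<partial>\<mu> n \<partial>\<mu> n)"
    unfolding mgf_def by (rule nn_integral_law_Suc) simp
  also have "\<dots> \<le> (\<integral>\<^sup>+ x. \<integral>\<^sup>+ y. ennreal (2 ^ K x) * ennreal (2 ^ K y) \<partial>\<mu> n \<partial>\<mu> n)"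
  proof (intro nn_integral_law_mono)
    fix x y :: real
    assume "0 \<le> x" "0 \<le> y"
    then have "(2 :: real) ^ K (max (x + y - 1) 0) \<le> 2 ^ (K x + K y)"
      using K[of x y] by (intro power_increasing) auto
    then show "ennreal (2 ^ K (max (x + y - 1) 0)) \<le> ennreal (2 ^ K x) * ennreal (2 ^ K y)"
      by (simp add: power_add ennreal_leI flip: ennreal_mult')
  qed
  also have "\<dots> = (mgf K 2 n)\<^sup>2"
    by (subst nn_integral_law_mult) (auto simp: mgf_def power2_eq_square)
  finally show ?thesis .
qed

text \<open>The hypothesis \<open>H_0 <= 0\<close> is inherited by every \<open>H_n\<close>; this
  bounds all means by 2, and division by \<open>2 ^ n\<close> sends them to 0.\<close>

lemma free_energy_eq_0_of_wmgf_le_mgf: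
  assumes "wmgf (\<lambda>x. nat \<lceil>x\<rceil>) 2 0 \<le> mgf (\<lambda>x. nat \<lceil>x\<rceil>) 2 0" "mgf (\<lambda>x. nat \<lceil>x\<rceil>) 2 0 < top"
  shows "dr_free_energy \<nu> p = 0"
proof -
  let ?K = "\<lambda>x :: real. nat \<lceil>x\<rceil>"
  have inv: "wmgf ?K 2 n \<le> mgf ?K 2 n \<and> mgf ?K 2 n < top" for n
  proof (induction n)
    case (Suc n)
    have "mgf ?K 2 (Suc n) \<le> (mgf ?K 2 n)\<^sup>2"
      by (rule mgf_2_Suc_le[OF _ ceiling_pred_add_le]) measurable
    also have "\<dots> < top" using Suc by (simp add: power_less_top_ennreal)
    finally have fin: "mgf ?K 2 (Suc n) < top" .
    have "(mgf ?K 2 n)\<^sup>2 + wmgf ?K 2 (Suc n) \<le> wmgf ?K 2 n * mgf ?K 2 n + mgf ?K 2 (Suc n)"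
      by (rule mgf_wmgf_recursion_le[OF _ ceiling_pred_add_le]) measurable
    also have "\<dots> \<le> (mgf ?K 2 n)\<^sup>2 + mgf ?K 2 (Suc n)"
      unfolding power2_eq_square using Suc by (intro add_right_mono mult_right_mono) auto
    finally show ?case
      using fin \<open>(mgf ?K 2 n)\<^sup>2 < top\<close> by (auto simp: ennreal_add_left_cancel_le)
  qed (use assms in simp)
  have mean: "mean (\<mu> n) \<le> 2" for n
  proof -
    \<comment> \<open>Equivalent to \<open>k <= psi 2 k + 2\<close>, so the mean is at most
      \<open>H_n + 2\<close>.\<close>
    have pw: "real k + 2 ^ k \<le> real k * 2 ^ k + 2" for k :: nat
    proof (cases k)
      case (Suc j)
      have "0 \<le> real j * (2 ^ k - 1)" by simp
      then show ?thesis by (simp add: Suc algebra_simps)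
    qed simp
    have "mgf ?K 2 n + mean (\<mu> n) = (\<integral>\<^sup>+ x. ennreal x + ennreal (2 ^ ?K x) \<partial>\<mu> n)"
      by (simp add: nn_integral_add mgf_def mean_def add.commute)
    also have "\<dots> \<le> (\<integral>\<^sup>+ x. ennreal (real (?K x) * 2 ^ ?K x) + 2 \<partial>\<mu> n)"
    proof (rule nn_integral_law_mono)
      fix x :: real
      assume "0 \<le> x"
      then have "x + 2 ^ ?K x \<le> real (?K x) * 2 ^ ?K x + 2"
        using pw[of "?K x"] real_nat_ceiling_ge[of x] by linarith
      from ennreal_leI[OF this] show "ennreal x + ennreal (2 ^ ?K x) \<le> ennreal (real (?K x) * 2 ^ ?K x) + 2"
        using \<open>0 \<le> x\<close> by simp
    qed
    also have "\<dots> = wmgf ?K 2 n + 2"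
      by (simp add: nn_integral_add nn_integral_law_const wmgf_def del: nn_integral_const)
    also have "\<dots> \<le> mgf ?K 2 n + 2" using inv by (intro add_right_mono) auto
    finally show ?thesis using inv[of n] by (auto simp: ennreal_add_left_cancel_le)
  qed
  have "(\<lambda>n. ennreal (2 * (1 / 2) ^ n)) \<longlonglongrightarrow> ennreal (2 * 0)"
    by (intro tendsto_intros LIMSEQ_power_zero) auto
  moreover have "mean (\<mu> n) / 2 ^ n \<le> ennreal (2 * (1 / 2) ^ n)" for n
  proof -
    have "mean (\<mu> n) / 2 ^ n \<le> ennreal 2 / ennreal (2 ^ n)"
      using mean[of n] by (simp add: divide_right_mono_ennreal ennreal_power[symmetric])
    also have "\<dots> = ennreal (2 * (1 / 2) ^ n)"
      by (subst divide_ennreal) (auto simp: power_divide)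
    finally show ?thesis .
  qed
  ultimately have "dr_free_energy \<nu> p \<le> ennreal (2 * 0)"
    by (intro LIMSEQ_le[OF dr_free_energy_LIMSEQ[OF prob_init sets_init p]]) auto
  then show ?thesis by simp
qed

end

lemma free_energy_eq_0_for_small_p:
  assumes \<nu>: "prob_space \<nu>" "sets \<nu> = sets borel" "AE x in \<nu>. 0 \<le> x"
    and fin: "(\<integral>\<^sup>+ x. ennreal (x * 2 powr x) \<partial>\<nu>) < \<infinity>"
  shows "\<exists>p\<in>{0<..1}. dr_free_energy \<nu> p = 0"
proof -
  let ?K = "\<lambda>x :: real. nat \<lceil>x\<rceil>"
  interpret prob_space \<nu> by fact
  have [measurable_cong]: "sets \<nu> = sets borel" by fact
  have pw: "real (?K x) * 2 ^ ?K x \<le> 8 + 4 * (x * 2 powr x)" if "0 \<le> x" for x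
  proof -
    define k where "k = ?K x"
    have k: "real k \<le> x + 1" using that unfolding k_def by linarith
    have "real k * 2 ^ k = real k * 2 powr real k" by (simp add: powr_realpow)
    also have "\<dots> \<le> (x + 1) * 2 powr (x + 1)"
      using that k by (intro mult_mono powr_mono) auto
    also have "\<dots> = 2 * (x + 1) * 2 powr x" by (simp add: powr_add)
    also have "\<dots> \<le> 8 + 4 * (x * 2 powr x)"
    proof (cases "x \<le> 1")
      case True
      then have "2 powr x \<le> 2 powr 1" by (intro powr_mono) auto
      then have "2 powr x \<le> 2" by simp
      moreover have "0 \<le> x * 2 powr x" using that by simp
      ultimately show ?thesis by (simp add: algebra_simps)
    next
      case False
      then have "1 * 2 powr x \<le> x * 2 powr x" by (intro mult_right_mono) auto
      then have "2 powr x \<le> x * 2 powr x" "0 \<le> x * 2 powr x" using that by simp_all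
      then show ?thesis by (simp only: distrib_left distrib_right mult.assoc)
    qed
    finally show ?thesis by (simp add: k_def)
  qed
  define I J where "I = (\<integral>\<^sup>+ x. ennreal (real (?K x) * 2 ^ ?K x) \<partial>\<nu>)"
    "J = (\<integral>\<^sup>+ x. ennreal (2 ^ ?K x) \<partial>\<nu>)"
  have "I \<le> (\<integral>\<^sup>+ x. 8 + 4 * ennreal (x * 2 powr x) \<partial>\<nu>)"
    unfolding I_J_def
  proof (rule nn_integral_mono_AE, use \<nu>(3) in eventually_elim)
    fix x :: real
    assume x: "0 \<le> x"
    from ennreal_leI[OF pw[OF x]] show "ennreal (real (?K x) * 2 ^ ?K x) \<le> 8 + 4 * ennreal (x * 2 powr x)"
      using x by (simp add: ennreal_mult)
  qed
  also have "\<dots> = 8 + 4 * (\<integral>\<^sup>+ x. ennreal (x * 2 powr x) \<partial>\<nu>)"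
    using emeasure_space_1 by (simp add: nn_integral_add nn_integral_cmult)
  also have "\<dots> < top" using fin by (simp add: ennreal_mult_less_top)
  finally have I: "I < top" .
  have "J \<le> (\<integral>\<^sup>+ x. 1 + ennreal (real (?K x) * 2 ^ ?K x) \<partial>\<nu>)"
    unfolding I_J_def
  proof (rule nn_integral_mono)
    fix x :: real
    have "(2 :: real) ^ ?K x \<le> 1 + real (?K x) * 2 ^ ?K x"
      by (cases "?K x") (auto simp: algebra_simps)
    from ennreal_leI[OF this] show "ennreal (2 ^ ?K x) \<le> 1 + ennreal (real (?K x) * 2 ^ ?K x)"
      by simp
  qed
  also have "\<dots> = 1 + I"
    using emeasure_space_1 by (simp add: nn_integral_add I_J_def)
  also have "\<dots> < top" using I by simp
  finally have J: "J < top" .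
  define i where "i = enn2real I"
  have i: "I = ennreal i" "0 \<le> i" using I by (auto simp: i_def)
  \<comment> \<open>With this \<open>p\<close>, the atom at 0 alone contributes
    \<open>1 - p >= p * i\<close> to \<open>mgf\<close> and nothing to \<open>wmgf\<close>, which
    yields \<open>H_0 <= 0\<close>. Finiteness of \<open>J\<close> only serves to make
    \<open>mgf\<close> finite.\<close>
  define p where "p = 1 / (2 + i)"
  have small: "0 < p" "p \<le> 1" "p * i \<le> 1 - p"
    using i(2) by (auto simp: p_def field_simps)
  interpret derrida_retaux \<nu> p
    by (rule derrida_retaux.intro[OF \<nu>]) (use small in auto)
  have "wmgf ?K 2 0 = ennreal (p * i)"
    using small i I_J_def(1) by (simp add: wmgf_def nn_integral_dr_init[OF sets_init] ennreal_mult')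
  moreover have mgf: "mgf ?K 2 0 = ennreal (1 - p) + ennreal p * J"
    by (simp add: mgf_def nn_integral_dr_init[OF sets_init] I_J_def(2)[symmetric])
  ultimately have "wmgf ?K 2 0 \<le> mgf ?K 2 0"
    using small(3) by (simp add: add_increasing2 ennreal_leI)
  moreover have "mgf ?K 2 0 < top"
    unfolding mgf using J by (simp add: ennreal_mult_less_top)
  ultimately have "dr_free_energy \<nu> p = 0"
    by (rule free_energy_eq_0_of_wmgf_le_mgf)
  then show ?thesis using small by auto
qed

theorem proposition1p2:
  fixes M :: "'a measure" and Y\<^sub>0 :: "'a \<Rightarrow> real"
  assumes "prob_space M"
    and "Y\<^sub>0 \<in> borel_measurable M"
    and "\<And>\<omega>. \<omega> \<in> space M \<Longrightarrow> Y\<^sub>0 \<omega> > 0"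
  shows "dr_critical_parameter (distr M borel Y\<^sub>0) > 0 \<longleftrightarrow>
    (\<integral>\<^sup>+ \<omega>. ennreal (Y\<^sub>0 \<omega> * 2 powr Y\<^sub>0 \<omega>) \<partial>M) < \<infinity>"
proof -
  note [measurable] = assms(2)
  define \<nu> where "\<nu> = distr M borel Y\<^sub>0"
  have "AE x in \<nu>. 0 \<le> x"
    unfolding \<nu>_def by (subst AE_distr_iff) (auto intro!: AE_I2 less_imp_le assms(3))
  then have \<nu>: "prob_space \<nu>" "sets \<nu> = sets borel" "AE x in \<nu>. 0 \<le> x"
    using prob_space.prob_space_distr[OF assms(1,2)] by (auto simp: \<nu>_def)
  define c where "c = dr_critical_parameter \<nu>"
  have c: "is_critical_parameter (dr_free_energy \<nu>) c"
    unfolding c_def by (rule is_critical_parameter_dr_critical_parameter[OF \<nu>])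
  have "(\<integral>\<^sup>+ \<omega>. ennreal (Y\<^sub>0 \<omega> * 2 powr Y\<^sub>0 \<omega>) \<partial>M) = (\<integral>\<^sup>+ x. ennreal (x * 2 powr x) \<partial>\<nu>)"
    unfolding \<nu>_def by (subst nn_integral_distr) auto
  moreover have "0 < c \<longleftrightarrow> (\<integral>\<^sup>+ x. ennreal (x * 2 powr x) \<partial>\<nu>) < \<infinity>"
  proof
    assume "0 < c"
    \<comment> \<open>Any parameter strictly between 0 and \<open>c\<close> has zero free energy;
      the midpoint is taken.\<close>
    then have p: "c / 2 \<in> {0..1}" "c / 2 < c" "0 < c / 2"
      using c by (simp_all add: is_critical_parameter_def)
    then have "dr_free_energy \<nu> (c / 2) = 0"
      using c unfolding is_critical_parameter_def by blast
    interpret derrida_retaux \<nu> "c / 2"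
      by (rule derrida_retaux.intro[OF \<nu> p(1)])
    show "(\<integral>\<^sup>+ x. ennreal (x * 2 powr x) \<partial>\<nu>) < \<infinity>"
      by (rule free_energy_eq_0_imp_finite) fact+
  next
    assume "(\<integral>\<^sup>+ x. ennreal (x * 2 powr x) \<partial>\<nu>) < \<infinity>"
    then obtain p where p: "0 < p" "p \<le> 1" "dr_free_energy \<nu> p = 0"
      using free_energy_eq_0_for_small_p[OF \<nu>] by auto
    show "0 < c"
    proof (rule ccontr)
      assume "\<not> 0 < c"
      then have "p \<in> {0..1}" "c < p" using p(1,2) by auto
      then have "dr_free_energy \<nu> p > 0"
        using c unfolding is_critical_parameter_def by blast
      then show False using p(3) by simp
    qed
  qed
  ultimately show ?thesis by (simp add: c_def \<nu>_def)
qed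

end
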